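(* Let $q=2n+1$ be an odd prime power with $q\equiv 3\pmod 4$, and let $\chi_q$ be a generator of the group $\widehat{\mathbb{F}_q^{\times}}$ of multiplicative characters of $\mathbb{F}_q$. Let $$I_q(\chi_q)=\prod_{0<k<n/2}\left(J_q(\phi,\chi_q^k)-J_q(\phi,\chi_q^{-k})\right).$$ Then $$x_q:=\frac{I_q(\chi_q)}{\sqrt{(-1)^{\frac{n-1}{2}}\cdot n}}\in\mathbb{Z}.$$ Moreover, $$x_q^2=2^{n-1}\cdot \det\left[\phi(s_i-s_j)\right]_{2\le i,j\le n}.$$
   Context: $\mathbb{F}_q$ is the finite field with $q=2n+1$ elements, $q$ an odd prime power. $\widehat{\mathbb{F}_q^{\times}}$ is the cyclic group (of order $q-1$) of complex-valued multiplicative characters of $\mathbb{F}_q^\times$; every character $\chi_q^k$ (including the trivial one) is extended to $\mathbb{F}_q$ by $\chi_q^k(0)=0$. $\phi=\chi_q^{n}$ is the quadratic character: $\phi(x)=1$ if $x$ is a nonzero square, $\phi(0)=0$, $\phi(x)=-1$ if $x$ is a nonsquare. The Jacobi sum is $J_q(\chi_q^i,\chi_q^j)=\sum_{x\in\mathbb{F}_q}\chi_q^i(x)\chi_q^j(1-x)$. The set of squares of $\mathbb{F}_q$ is enumerated as $\{x^2:x\in\mathbb{F}_q\}=\{s_0=0,s_1=1,s_2,\dots,s_n\}$ with the $s_i$ distinct. The product defining $I_q(\chi_q)$ runs over integers $k$ with $0<k<n/2$; empty products and the determinant of the empty matrix equal $1$. For a negative real number $-N$, $\sqrt{-N}$ means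 $\boldsymbol{i}\sqrt{N}$, where $\boldsymbol{i}$ is the imaginary unit. *)

theory Defs
  imports
    Complex_Main
    "HOL-Computational_Algebra.Primes"
    "Jordan_Normal_Form.Determinant"
begin

text \<open>
  Characters of the multiplicative group of a finite field are represented as total functions
  on the field. They take the value 0 at 0, the trivial character included.
\<close>

definition mult_chars :: "('a::finite_field \<Rightarrow> complex) set" where
  "mult_chars = {\<chi>. \<chi> 0 = 0 \<and> (\<forall>x. x \<noteq> 0 \<longrightarrow> \<chi> x \<noteq> 0) \<and>
     (\<forall>x y. x \<noteq> 0 \<longrightarrow> y \<noteq> 0 \<longrightarrow> \<chi> (x * y) = \<chi> x * \<chi> y)}"

text \<open>
  Powers in the character group. The case distinction is needed because \<^term>\<open>(0::complex) powi 0 = 1\<close>,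
  whereas the trivial character vanishes at 0.
\<close>

definition char_pow :: "('a::finite_field \<Rightarrow> complex) \<Rightarrow> int \<Rightarrow> 'a \<Rightarrow> complex" where
  "char_pow \<chi> k = (\<lambda>x. if x = 0 then 0 else \<chi> x powi k)"

definition char_generator :: "('a::finite_field \<Rightarrow> complex) \<Rightarrow> bool" where
  "char_generator \<chi> \<longleftrightarrow> \<chi> \<in> mult_chars \<and> mult_chars = range (char_pow \<chi>)"

definition quad_char :: "'a::finite_field \<Rightarrow> complex" where
  "quad_char x = (if x = 0 then 0 else if \<exists>y. x = y\<^sup>2 then 1 else -1)"

definition jacobi_sum ::
  "('a::finite_field \<Rightarrow> complex) \<Rightarrow> ('a \<Rightarrow> complex) \<Rightarrow> complex" where
  "jacobi_sum \<chi> \<psi> = (\<Sum>x\<in>UNIV. \<chi> x * \<psi> (1 - x))"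

text \<open>The parameter \<open>n\<close> is meant to be half of the order of the multiplicative group.\<close>

definition jacobi_diff_prod :: "nat \<Rightarrow> ('a::finite_field \<Rightarrow> complex) \<Rightarrow> complex" where
  "jacobi_diff_prod n \<chi> = (\<Prod>k | 0 < k \<and> real_of_int k < real n / 2.
     jacobi_sum quad_char (char_pow \<chi> k) - jacobi_sum quad_char (char_pow \<chi> (- k)))"

end

theory Submission
  imports Defs "HOL-Algebra.Multiplicative_Group"
begin

text \<open>
  Let \<open>S\<close> be the group of nonzero squares, cyclic of odd order \<open>n = 2m + 1\<close>, and put
  \<open>\<mu>\<^sub>k = \<Sum>a\<in>S. \<phi>(1 - a) \<chi>(a)^k\<close>. Substituting \<open>1/x\<close> for \<open>x\<close> in the second Jacobi sum turns the
  \<open>k\<close>-th factor of the product into \<open>2 \<mu>\<^sub>k\<close>, and \<open>\<phi>(-1) = -1\<close> gives \<open>\<mu>\<^sub>n\<^sub>-\<^sub>k = -\<mu>\<^sub>k\<close>.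
  The \<open>\<mu>\<^sub>k\<close> are the eigenvalues of the group matrix \<open>(\<phi>(a - b))\<close>, \<open>a, b \<in> S\<close>. As \<open>\<mu>\<^sub>0 = 0\<close>, the
  product of the others is \<open>n\<close> times the minor obtained by deleting the row and the column of 1,
  which yields the determinant formula. For integrality, convolution with the odd function
  \<open>\<phi>(a - 1)\<close> maps odd functions on \<open>S\<close> to even ones. Comparing its integer matrix in the standard
  basis with its diagonal form in the basis of odd and even parts of characters shows that
  \<open>(\<mu>\<^sub>1 \<cdots> \<mu>\<^sub>m)\<^sup>2 = (-1)^m n r\<^sup>2\<close> with an integer \<open>r\<close>.
\<close>

section \<open>Determinants\<close>

lemma mat_mult_mat:
  "mat r m f * mat m p g =
     mat r p (\<lambda>(i, j). \<Sum>k<m. f (i, k) * (g (k, j) :: 'a :: comm_semiring_1))"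
  by (rule eq_matI) (auto simp: scalar_prod_def atLeast0LessThan)

lemma mat_mult_transpose_mat:
  "mat r m f * transpose_mat (mat p m g) =
     mat r p (\<lambda>(i, j). \<Sum>k<m. f (i, k) * (g (j, k) :: 'a :: comm_semiring_1))"
  by (rule eq_matI) (auto simp: scalar_prod_def atLeast0LessThan)

lemma det_diagonal_mat:
  "det (mat m m (\<lambda>(i, j). if i = j then d i else 0)) = (\<Prod>i<m. d i :: 'a :: comm_ring_1)"
proof -
  let ?D = "mat m m (\<lambda>(i, j). if i = j then d i else 0)"
  have "upper_triangular ?D" by auto
  then have "det ?D = prod_list (diag_mat ?D)"
    by (rule det_upper_triangular) auto
  then show ?thesis by (simp add: prod_list_diag_prod atLeast0LessThan)
qed

text \<open>The matrix is aI + bJ with J the all-ones matrix. The all-ones vector is an eigenvector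
  for a + mb, and modulo its span the matrix acts as a. The extra factor a on the left avoids the
  exponent m - 1 and covers m = 0.\<close>

lemma det_scalar_plus_const:
  fixes a b :: "'a :: idom"
  shows "a * det (mat m m (\<lambda>(i, j). if i = j then a + b else b)) = a ^ m * (a + of_nat m * b)"
proof (cases m)
  case 0
  then show ?thesis by (simp add: det_dim_zero)
next
  case (Suc p)
  define A where "A = mat m m (\<lambda>(i, j). if i = j then a + b else b)"
  define L where "L = mat m m (\<lambda>(i, j). if i = j \<or> j = 0 then 1 else 0 :: 'a)"
  define U where "U = mat m m (\<lambda>(i, j). if i = 0 \<and> j = 0 then a + of_nat m * b
    else if i = 0 then b else if i = j then a else 0)"
  have dL: "det L = 1"
    using det_lower_triangular[of m L] by (simp add: L_def prod_list_diag_prod)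
  have "upper_triangular U" by (auto simp: U_def)
  then have "det U = (\<Prod>i<m. U $$ (i, i))"
    by (subst det_upper_triangular[of U m]) (auto simp: U_def prod_list_diag_prod atLeast0LessThan)
  also have "\<dots> = (a + of_nat m * b) * a ^ p"
    by (simp add: Suc U_def prod.lessThan_Suc_shift del: prod.lessThan_Suc)
  finally have dU: "det U = (a + of_nat m * b) * a ^ p" .
  \<comment> \<open>\<open>L\<close> is the base change that replaces the first unit vector by the
    all-ones vector; in this basis \<open>A\<close> becomes the triangular \<open>U\<close>.\<close>
  have "A * L = L * U"
    unfolding A_def L_def U_def mat_mult_mat
  proof (rule eq_matI, simp_all, goal_cases)
    case (1 i j)
    have "(\<Sum>k<m. (if i = k then a + b else b) * (if k = j \<or> j = 0 then 1 else 0))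
        = (if j = 0 then a + of_nat m * b else if i = j then a + b else b)"
    proof (cases "j = 0")
      case True
      have "(\<Sum>k<m. (if i = k then a + b else b)) = (\<Sum>k<m. (if i = k then a else 0) + b)"
        by (rule sum.cong) auto
      with True 1 show ?thesis by (simp add: sum.distrib)
    next
      case False
      then have "(\<Sum>k<m. (if i = k then a + b else b) * (if k = j \<or> j = 0 then 1 else 0))
        = (\<Sum>k<m. if k = j then (if i = k then a + b else b) else 0)"
        by (intro sum.cong) auto
      with False 1 show ?thesis by simp
    qed
    moreover have "(\<Sum>k<m. (if i = k \<or> k = 0 then 1 else 0) *
          (if k = 0 \<and> j = 0 then a + of_nat m * b else if k = 0 then b else if k = j then a else 0))
        = (if j = 0 then a + of_nat m * b else b) + (if i = j \<and> i \<noteq> 0 then a else 0)"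
    proof -
      have "(\<Sum>k<m. (if i = k \<or> k = 0 then 1 else 0) *
          (if k = 0 \<and> j = 0 then a + of_nat m * b else if k = 0 then b else if k = j then a else 0))
        = (\<Sum>k<m. (if k = 0 then (if j = 0 then a + of_nat m * b else b) else 0) +
           (if k = i then if i = j \<and> i \<noteq> 0 then a else 0 else 0))"
        by (rule sum.cong) auto
      then show ?thesis using 1 by (auto simp: sum.distrib)
    qed
    ultimately show ?case by simp
  qed
  moreover have "A \<in> carrier_mat m m" "L \<in> carrier_mat m m" "U \<in> carrier_mat m m"
    by (simp_all add: A_def L_def U_def)
  ultimately have "det A * det L = det L * det U"
    by (metis det_mult)
  then have "det A = (a + of_nat m * b) * a ^ p" by (simp add: dL dU)
  then show ?thesis by (simp add: A_def Suc mult_ac)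
qed

lemma det_in_Ints:
  fixes A :: "'a :: comm_ring_1 mat"
  assumes "A \<in> carrier_mat m m" and "\<And>i j. i < m \<Longrightarrow> j < m \<Longrightarrow> A $$ (i, j) \<in> \<int>"
  shows "det A \<in> \<int>"
  unfolding det_def'[OF assms(1)]
  by (intro Ints_sum Ints_mult Ints_prod Ints_of_int assms) (auto simp: permutes_nat_less)

section \<open>Characters of finite fields\<close>

lemma card_finite_field_gt_1: "1 < card (UNIV :: 'a :: finite_field set)"
proof -
  have "card {0, 1 :: 'a} \<le> card (UNIV :: 'a set)" by (rule card_mono) auto
  then show ?thesis by simp
qed

lemma finite_field_power_card_minus_1:
  fixes x :: "'a :: finite_field"
  assumes "x \<noteq> 0"
  shows "x ^ (card (UNIV :: 'a set) - 1) = 1"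
proof -
  have "Suc (card (UNIV :: 'a set) - 1) = card (UNIV :: 'a set)"
    using card_finite_field_gt_1[where 'a = 'a] by simp
  then have "x * x ^ (card (UNIV :: 'a set) - 1) = x"
    by (metis power_Suc finite_field_power_card_eq_same)
  with assms show ?thesis by simp
qed

lemma power_mod_exponent:
  fixes x :: "'a :: monoid_mult"
  assumes "x ^ N = 1"
  shows "x ^ (i mod N) = x ^ i"
proof -
  have "x ^ i = x ^ (N * (i div N) + i mod N)" by simp
  also have "\<dots> = x ^ (i mod N)" unfolding power_add power_mult assms by simp
  finally show ?thesis ..
qed

text \<open>Cyclicity is known for fields given as records, so the type is packed into the record
  \<open>?R\<close>. Reducing exponents modulo the group order leaves a surjection between sets of
  equal size, hence a bijection.\<close>

lemma finite_field_ex_generator: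
  "\<exists>g :: 'a :: finite_field. g \<noteq> 0 \<and> bij_betw (\<lambda>i. g ^ i) {..<card (UNIV :: 'a set) - 1} (UNIV - {0})"
proof -
  let ?R = "\<lparr>carrier = UNIV, mult = (*), one = 1, zero = 0, add = (+)\<rparr> :: 'a ring"
  define N where "N = card (UNIV :: 'a set) - 1"
  have N: "N > 0" using card_finite_field_gt_1[where 'a = 'a] by (simp add: N_def)
  have "ring ?R"
    by unfold_locales
      (auto simp: algebra_simps Units_def intro: exI[of _ "- x" for x] add.left_inverse add.right_inverse)
  then interpret ring ?R .
  interpret field ?R
  proof unfold_locales
    show "Units ?R = carrier ?R - {\<zero>\<^bsub>?R\<^esub>}"
      by (auto simp: Units_def) (metis left_inverse right_inverse)
  qed (auto simp: algebra_simps)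
  have pow: "x [^]\<^bsub>?R\<^esub> (i :: nat) = x ^ i" for x i
    by (induction i) (simp_all add: mult.commute)
  obtain g :: 'a where g: "g \<noteq> 0" and all: "UNIV - {0} = range (\<lambda>i :: nat. g ^ i)"
    using finite_field_mult_group_has_gen by (auto simp: mult_of_simps pow image_def)
  have "g ^ i = g ^ (i mod N)" for i
    using finite_field_power_card_minus_1[OF g] by (simp add: power_mod_exponent N_def)
  moreover have "i mod N \<in> {..<N}" for i using N by simp
  ultimately have img: "(\<lambda>i. g ^ i) ` {..<N} = UNIV - {0}"
    unfolding all by blast
  have "card (UNIV - {0 :: 'a}) = N" by (simp add: N_def card_Diff_singleton)
  with img have "inj_on (\<lambda>i. g ^ i) {..<N}" by (intro eq_card_imp_inj_on) auto
  with img g show ?thesis by (auto simp: bij_betw_def N_def)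
qed

text \<open>A faithful character: it sends a primitive root to a primitive root of unity of the full
  order N. \<open>ind\<close> is the discrete logarithm.\<close>

lemma ex_separating_mult_char:
  "\<exists>\<psi> \<in> mult_chars. \<forall>x :: 'a :: finite_field. \<psi> x = 1 \<longrightarrow> x = 1"
proof -
  define N where "N = card (UNIV :: 'a set) - 1"
  obtain g :: 'a where g: "g \<noteq> 0" and bij: "bij_betw (\<lambda>i. g ^ i) {..<N} (UNIV - {0})"
    using finite_field_ex_generator unfolding N_def by blast
  have N: "N > 0" using card_finite_field_gt_1[where 'a = 'a] by (simp add: N_def)
  define ind where "ind = inv_into {..<N} (\<lambda>i. g ^ i)"
  have ind: "ind x < N" "g ^ ind x = x" if "x \<noteq> 0" for x
    using bij that inv_into_into[of x "\<lambda>i. g ^ i" "{..<N}"] f_inv_into_f[of x "\<lambda>i. g ^ i" "{..<N}"]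
    by (auto simp: bij_betw_def ind_def)
  have ind_eq: "ind (g ^ i) = i mod N" for i
  proof -
    have "ind (g ^ (i mod N)) = i mod N"
      using bij N by (simp add: ind_def bij_betw_def inv_into_f_f)
    then show ?thesis
      using finite_field_power_card_minus_1[OF g] by (simp add: power_mod_exponent N_def)
  qed
  define \<zeta> where "\<zeta> = cis (2 * pi / real N)"
  have \<zeta>N: "\<zeta> ^ N = 1" using N by (simp add: \<zeta>_def DeMoivre)
  have \<zeta>inj: "i = 0" if "\<zeta> ^ i = 1" "i < N" for i
  proof -
    have inj: "inj_on (\<lambda>k. cis (2 * pi * real k / real N)) {..<N}"
      using bij_betw_roots_unity[OF N] by (simp add: bij_betw_def)
    have "cis (2 * pi * real i / real N) = cis (2 * pi * real 0 / real N)"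
      using that(1) by (simp add: \<zeta>_def DeMoivre mult_ac)
    from inj_onD[OF inj this] that(2) N show ?thesis by simp
  qed
  define \<psi> where "\<psi> x = (if x = 0 then 0 else \<zeta> ^ ind x)" for x
  have "\<psi> \<in> mult_chars"
  proof -
    have "\<zeta> \<noteq> 0" by (simp add: \<zeta>_def)
    moreover have "\<zeta> ^ ind (x * y) = \<zeta> ^ ind x * \<zeta> ^ ind y" if "x \<noteq> 0" "y \<noteq> 0" for x y
    proof -
      have "ind (x * y) = (ind x + ind y) mod N"
        using ind_eq[of "ind x + ind y"] that by (simp add: ind power_add)
      then show ?thesis by (simp add: power_mod_exponent[OF \<zeta>N] power_add)
    qed
    ultimately show ?thesis by (simp add: mult_chars_def \<psi>_def)
  qed
  moreover have "x = 1" if "\<psi> x = 1" for x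
    using that \<zeta>inj[of "ind x"] ind[of x] by (auto simp: \<psi>_def split: if_splits)
  ultimately show ?thesis by blast
qed

section \<open>A generating character and the quadratic character for q = 2n + 1 = 4m + 3\<close>

locale quadratic_residues =
  fixes \<chi> :: "'a :: finite_field \<Rightarrow> complex" and m n :: nat
  assumes card_UNIV: "card (UNIV :: 'a set) = 2 * n + 1"
    and n: "n = 2 * m + 1"
    and gen: "char_generator \<chi>"
begin

lemma n_nonzero: "n \<noteq> 0"
  by (simp add: n)

lemma chi_0: "\<chi> 0 = 0"
  and chi_nonzero: "x \<noteq> 0 \<Longrightarrow> \<chi> x \<noteq> 0"
  and chi_mult: "\<chi> (x * y) = \<chi> x * \<chi> y"
proof -
  have \<chi>: "\<chi> \<in> mult_chars" using gen by (simp add: char_generator_def)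
  then show 0: "\<chi> 0 = 0" and "x \<noteq> 0 \<Longrightarrow> \<chi> x \<noteq> 0" by (simp_all add: mult_chars_def)
  show "\<chi> (x * y) = \<chi> x * \<chi> y"
    using \<chi> 0 by (cases "x = 0 \<or> y = 0") (auto simp: mult_chars_def)
qed

lemma chi_1: "\<chi> 1 = 1"
  using chi_mult[of 1 1] chi_nonzero[of 1] by simp

lemma chi_power: "\<chi> (x ^ i) = \<chi> x ^ i"
  by (induction i) (simp_all add: chi_1 chi_mult)

lemma chi_inverse: "\<chi> (inverse x) = inverse (\<chi> x)"
proof (cases "x = 0")
  case False
  then have "\<chi> x * \<chi> (inverse x) = 1" by (simp flip: chi_mult add: chi_1)
  then show ?thesis by (metis inverse_unique)
qed (simp add: chi_0)

text \<open>The faithful character constructed above is a power of the generator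
  \<open>\<chi>\<close>, so the kernel of \<open>\<chi>\<close> lies in a trivial kernel.\<close>

lemma chi_eq_1_iff: "\<chi> x = 1 \<longleftrightarrow> x = 1"
proof
  assume x: "\<chi> x = 1"
  obtain \<psi> :: "'a \<Rightarrow> complex" where \<psi>: "\<psi> \<in> mult_chars" "\<And>x. \<psi> x = 1 \<Longrightarrow> x = 1"
    using ex_separating_mult_char by blast
  then obtain k where "\<psi> = char_pow \<chi> k" using gen by (auto simp: char_generator_def)
  then have "\<psi> x = 1" using x chi_0 by (auto simp: char_pow_def)
  then show "x = 1" by (rule \<psi>)
qed (simp add: chi_1)

lemma power_2n: "x \<noteq> 0 \<Longrightarrow> (x :: 'a) ^ (2 * n) = 1"
  using finite_field_power_card_minus_1[of x] by (simp add: card_UNIV)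

text \<open>For a primitive root g, both g^n and \<chi>(g)^n are square roots of 1 other than 1,
  hence -1. So \<chi>^n maps g^i to (-1)^i, and the parity of i decides whether g^i is a
  square.\<close>

lemma chi_power_n: "x \<noteq> 0 \<Longrightarrow> \<chi> x ^ n = quad_char x"
  and chi_minus_1: "\<chi> (- 1) = - 1"
proof -
  obtain g :: 'a where g: "g \<noteq> 0" and bij: "bij_betw (\<lambda>i. g ^ i) {..<2 * n} (UNIV - {0})"
    using finite_field_ex_generator[where 'a = 'a] by (auto simp: card_UNIV)
  have "g ^ n \<noteq> g ^ 0"
    using inj_onD[OF bij_betw_imp_inj_on[OF bij], of n 0] n by auto
  then have gn: "g ^ n \<noteq> 1" by simp
  have "(g ^ n)\<^sup>2 = 1" using power_2n[OF g] by (simp add: power_mult mult.commute)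
  with gn have gn': "g ^ n = - 1" by (auto simp: power2_eq_1_iff)
  have "(\<chi> g ^ n)\<^sup>2 = 1" using power_2n[OF g]
    by (metis chi_power chi_1 power_mult mult.commute)
  moreover have "\<chi> g ^ n \<noteq> 1" using gn by (metis chi_power chi_eq_1_iff)
  ultimately have e: "\<chi> g ^ n = - 1" by (auto simp: power2_eq_1_iff)
  show "\<chi> (- 1) = - 1" using e gn' by (metis chi_power)
  show "\<chi> x ^ n = quad_char x" if x: "x \<noteq> 0"
  proof -
    obtain i where i: "x = g ^ i" using x bij by (auto simp: bij_betw_def image_def)
    have "\<chi> x ^ n = (\<chi> g ^ n) ^ i"
      unfolding i chi_power power_mult[symmetric] by (simp add: mult.commute)
    then have *: "\<chi> x ^ n = (- 1) ^ i" by (simp add: e)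
    show ?thesis
    proof (cases "even i")
      case True
      then have "x = (g ^ (i div 2))\<^sup>2" by (simp add: i flip: power_mult)
      with True x * show ?thesis by (auto simp: quad_char_def)
    next
      case False
      have "\<nexists>y. x = y\<^sup>2"
      proof
        assume "\<exists>y. x = y\<^sup>2"
        then obtain y where y: "x = y\<^sup>2" by blast
        then have "\<chi> x ^ n = \<chi> (y ^ (2 * n))" by (simp add: chi_power power_mult)
        also have "\<dots> = 1" using x y by (simp add: power_2n chi_1)
        finally show False using * False by simp
      qed
      with False x * show ?thesis by (auto simp: quad_char_def)
    qed
  qed
qed

lemma quad_char_0: "quad_char (0 :: 'a) = 0"
  by (simp add: quad_char_def)

lemma quad_char_mult: "quad_char (x * y :: 'a) = quad_char x * quad_char y"
  by (cases "x = 0 \<or> y = 0")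
     (auto simp: quad_char_0 chi_mult power_mult_distrib simp flip: chi_power_n)

text \<open>Here q = 3 mod 4 enters: n is odd, so \<phi>(-1) = (-1)^n = -1. All later antisymmetry
  rests on this.\<close>

lemma quad_char_uminus: "quad_char (- x :: 'a) = - quad_char x"
proof -
  have "quad_char (- 1 :: 'a) = \<chi> (- 1) ^ n" by (subst chi_power_n) auto
  also have "\<dots> = - 1" by (simp add: chi_minus_1 n)
  finally show ?thesis using quad_char_mult[of "- 1" x] by simp
qed

lemma quad_char_diff_commute: "quad_char (x - y :: 'a) = - quad_char (y - x)"
  using quad_char_uminus[of "y - x"] by simp

lemma quad_char_in_Ints: "quad_char x \<in> \<int>"
  by (simp add: quad_char_def)

section \<open>The cyclic group of nonzero squares\<close>

definition Sq :: "'a set" where "Sq = {x. quad_char x = 1}"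

lemma Sq_iff: "x \<in> Sq \<longleftrightarrow> x \<noteq> 0 \<and> (\<exists>y. x = y\<^sup>2)"
  by (simp add: Sq_def quad_char_def)

lemma Sq_nonzero: "x \<in> Sq \<Longrightarrow> x \<noteq> 0"
  by (simp add: Sq_iff)

lemma one_in_Sq: "1 \<in> Sq"
  by (auto simp: Sq_iff intro: exI[of _ 1])

lemma Sq_mult: "x \<in> Sq \<Longrightarrow> y \<in> Sq \<Longrightarrow> x * y \<in> Sq"
  by (simp add: Sq_def quad_char_mult)

lemma Sq_inverse:
  assumes "x \<in> Sq"
  shows "inverse x \<in> Sq"
proof -
  obtain y where "x = y\<^sup>2" using assms by (auto simp: Sq_iff)
  then have "inverse x = (inverse y)\<^sup>2" by (simp add: power_inverse)
  then show ?thesis using Sq_nonzero[OF assms] unfolding Sq_iff by auto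
qed

lemma Sq_divide: "x \<in> Sq \<Longrightarrow> y \<in> Sq \<Longrightarrow> x / y \<in> Sq"
  by (simp add: divide_inverse Sq_mult Sq_inverse)

lemma finite_Sq: "finite Sq"
  by simp

lemma quad_char_Sq_mult: "x \<in> Sq \<Longrightarrow> quad_char (x * y) = quad_char y"
  by (simp add: quad_char_mult Sq_def)

lemma chi_Sq_power_n: "x \<in> Sq \<Longrightarrow> \<chi> x ^ n = 1"
  using chi_power_n[OF Sq_nonzero] by (simp add: Sq_def)

lemma ex_Sq_generator: "\<exists>h \<in> Sq. bij_betw (\<lambda>i. h ^ i) {..<n} Sq"
proof -
  obtain g :: 'a where g: "g \<noteq> 0" and bij: "bij_betw (\<lambda>i. g ^ i) {..<2 * n} (UNIV - {0})"
    using finite_field_ex_generator[where 'a = 'a] by (auto simp: card_UNIV)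
  have "inj_on (\<lambda>i. (g\<^sup>2) ^ i) {..<n}"
  proof (rule inj_onI)
    fix i j assume "i \<in> {..<n}" "j \<in> {..<n}" "(g\<^sup>2) ^ i = (g\<^sup>2) ^ j"
    then show "i = j"
      using inj_onD[OF bij_betw_imp_inj_on[OF bij], of "2 * i" "2 * j"] by (simp flip: power_mult)
  qed
  moreover have "(\<lambda>i. (g\<^sup>2) ^ i) ` {..<n} = Sq"
  proof (intro equalityI subsetI)
    fix x assume "x \<in> (\<lambda>i. (g\<^sup>2) ^ i) ` {..<n}"
    then obtain i where "x = (g ^ i)\<^sup>2" by (auto simp: mult.commute simp flip: power_mult)
    with g show "x \<in> Sq" by (auto simp: Sq_iff)
  next
    fix x assume "x \<in> Sq"
    then obtain y where y: "x = y\<^sup>2" "y \<noteq> 0" by (auto simp: Sq_iff)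
    then obtain i where "y = g ^ i" using bij by (auto simp: bij_betw_def image_def)
    then have "x = (g\<^sup>2) ^ i" using y by (simp add: mult.commute flip: power_mult)
    also have "\<dots> = (g\<^sup>2) ^ (i mod n)"
      using power_mod_exponent[of "g\<^sup>2" n i] power_2n[OF g] by (simp add: power_mult)
    finally show "x \<in> (\<lambda>i. (g\<^sup>2) ^ i) ` {..<n}" using n by auto
  qed
  moreover have "g\<^sup>2 \<in> Sq" using g by (auto simp: Sq_iff)
  ultimately show ?thesis by (auto simp: bij_betw_def)
qed

definition h :: 'a where "h = (SOME h. h \<in> Sq \<and> bij_betw (\<lambda>i. h ^ i) {..<n} Sq)"

lemma h_in_Sq: "h \<in> Sq" and bij_h: "bij_betw (\<lambda>i. h ^ i) {..<n} Sq"
  using someI_ex[OF ex_Sq_generator[unfolded Bex_def]] unfolding h_def by auto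

lemma h_power_in_Sq: "h ^ i \<in> Sq"
  by (induction i) (auto intro: one_in_Sq Sq_mult h_in_Sq)

lemma h_power_n: "h ^ n = 1"
  using chi_Sq_power_n[OF h_in_Sq] by (metis chi_power chi_eq_1_iff)

lemma h_power_eq_iff: "i < n \<Longrightarrow> j < n \<Longrightarrow> h ^ i = h ^ j \<longleftrightarrow> i = j"
  using bij_betw_imp_inj_on[OF bij_h] by (auto dest: inj_onD)

lemma h_power_minus: "i \<le> n \<Longrightarrow> h ^ (n - i) = inverse (h ^ i)"
  using h_power_n Sq_nonzero[OF h_in_Sq]
  by (simp add: power_diff inverse_eq_divide)

lemma Suc_le_n: "j < m \<Longrightarrow> Suc j \<le> n"
  by (simp add: n)

text \<open>The exponents i and n - i are paired. As n is odd, 0 is the only one left alone. The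
  pairing is inversion in \<open>Sq\<close> for powers of \<open>h\<close>, and conjugation of
  characters for powers of \<open>\<chi>\<close>.\<close>

lemma sum_lessThan_n_split:
  "(\<Sum>i<n. F i) = F 0 + (\<Sum>j<m. F (Suc j) + F (n - Suc j) :: 'b :: comm_monoid_add)"
proof -
  have "(\<Sum>i<n. F i) = F 0 + (\<Sum>i<m + m. F (Suc i))"
    by (simp add: n sum.lessThan_Suc_shift mult_2 del: sum.lessThan_Suc)
  also have "(\<Sum>i<m + m. F (Suc i)) = (\<Sum>i<m. F (Suc i)) + (\<Sum>i=m..<m + m. F (Suc i))"
    by (metis sum.atLeastLessThan_concat atLeast0LessThan le0 le_add1)
  also have "(\<Sum>i=m..<m + m. F (Suc i)) = (\<Sum>j<m. F (n - Suc j))"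
    by (rule sum.reindex_bij_witness[of _ "\<lambda>j. 2 * m - Suc j" "\<lambda>i. 2 * m - Suc i"])
       (auto simp: n)
  finally show ?thesis by (simp add: sum.distrib add.assoc)
qed

lemma sum_Sq_split:
  "(\<Sum>a\<in>Sq. F a) = F 1 + (\<Sum>j<m. F (h ^ Suc j) + F (inverse (h ^ Suc j)) :: 'b :: comm_monoid_add)"
proof -
  have "(\<Sum>a\<in>Sq. F a) = (\<Sum>i<n. F (h ^ i))"
    by (rule sum.reindex_bij_betw[OF bij_h, symmetric])
  also have "\<dots> = F (h ^ 0) + (\<Sum>j<m. F (h ^ Suc j) + F (h ^ (n - Suc j)))"
    by (rule sum_lessThan_n_split)
  also have "\<dots> = F 1 + (\<Sum>j<m. F (h ^ Suc j) + F (inverse (h ^ Suc j)))"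
    using h_power_minus Suc_le_n by (simp del: power_Suc)
  finally show ?thesis .
qed

section \<open>Orthogonality relations on the group of squares\<close>

lemma sum_chi_powers:
  assumes "a \<in> Sq"
  shows "(\<Sum>k<n. \<chi> a ^ k) = (if a = 1 then of_nat n else 0)"
  using chi_Sq_power_n[OF assms] chi_eq_1_iff[of a]
  by (auto simp: geometric_sum chi_1)

lemma chi_power_minus:
  assumes "a \<in> Sq" "k \<le> n"
  shows "\<chi> a ^ (n - k) = \<chi> (inverse a) ^ k"
proof -
  have "\<chi> a ^ (n - k) = inverse (\<chi> a ^ k)"
    using assms chi_Sq_power_n[OF assms(1)] chi_nonzero[OF Sq_nonzero[OF assms(1)]]
    by (simp add: power_diff inverse_eq_divide)
  then show ?thesis by (simp add: chi_inverse power_inverse)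
qed

lemma sum_chi_powers_half:
  assumes "a \<in> Sq"
  shows "(\<Sum>k<m. \<chi> a ^ Suc k + \<chi> (inverse a) ^ Suc k) = (if a = 1 then of_nat n else 0) - 1"
proof -
  have "(\<Sum>k<n. \<chi> a ^ k) = 1 + (\<Sum>k<m. \<chi> a ^ Suc k + \<chi> a ^ (n - Suc k))"
    by (subst sum_lessThan_n_split) simp
  also have "(\<Sum>k<m. \<chi> a ^ Suc k + \<chi> a ^ (n - Suc k))
      = (\<Sum>k<m. \<chi> a ^ Suc k + \<chi> (inverse a) ^ Suc k)"
    using assms chi_power_minus Suc_le_n by (simp del: power_Suc)
  finally show ?thesis using sum_chi_powers[OF assms] by (simp add: algebra_simps)
qed

lemma sum_Sq_chi_power:
  assumes "0 < k" "k < n"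
  shows "(\<Sum>a\<in>Sq. \<chi> a ^ k) = 0"
proof -
  have "(\<Sum>a\<in>Sq. \<chi> a ^ k) = (\<Sum>i<n. \<chi> (h ^ i) ^ k)"
    by (rule sum.reindex_bij_betw[OF bij_h, symmetric])
  also have "\<dots> = (\<Sum>i<n. \<chi> (h ^ k) ^ i)"
    by (intro sum.cong) (simp_all add: chi_power mult.commute flip: power_mult)
  also have "\<dots> = 0"
    using assms h_power_eq_iff[of k 0] by (simp add: sum_chi_powers h_power_in_Sq)
  finally show ?thesis .
qed

section \<open>Eigenvalues and Jacobi sums\<close>

definition mu :: "nat \<Rightarrow> complex" where
  "mu k = (\<Sum>a\<in>Sq. quad_char (1 - a) * \<chi> a ^ k)"

lemma sum_Sq_inverse: "(\<Sum>a\<in>Sq. F (inverse a)) = (\<Sum>a\<in>Sq. F a)"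
  by (rule sum.reindex_bij_witness[of _ inverse inverse]) (auto simp: Sq_inverse)

text \<open>Put c = ba: since b is a square, \<phi>(b - ba) = \<phi>(1 - a). On \<open>Sq\<close>
  the kernel thus depends only on c/b up to this substitution, and characters are its
  eigenvectors.\<close>

lemma mu_convolution:
  assumes "b \<in> Sq"
  shows "(\<Sum>c\<in>Sq. quad_char (b - c) * \<chi> c ^ k) = mu k * \<chi> b ^ k"
proof -
  have "(\<Sum>c\<in>Sq. quad_char (b - c) * \<chi> c ^ k) = (\<Sum>a\<in>Sq. quad_char (b - b * a) * \<chi> (b * a) ^ k)"
    by (rule sum.reindex_bij_witness[of _ "\<lambda>a. b * a" "\<lambda>c. c / b"])
       (use assms Sq_nonzero in \<open>auto simp: Sq_mult Sq_divide\<close>)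
  also have "\<dots> = (\<Sum>a\<in>Sq. quad_char (1 - a) * \<chi> a ^ k * \<chi> b ^ k)"
  proof (intro sum.cong refl)
    fix a
    have "quad_char (b * (1 - a)) = quad_char (1 - a)"
      using assms by (rule quad_char_Sq_mult)
    then show "quad_char (b - b * a) * \<chi> (b * a) ^ k = quad_char (1 - a) * \<chi> a ^ k * \<chi> b ^ k"
      by (simp add: right_diff_distrib chi_mult power_mult_distrib)
  qed
  also have "\<dots> = mu k * \<chi> b ^ k"
    by (simp add: mu_def sum_distrib_right)
  finally show ?thesis .
qed

lemma quad_char_one_minus_inverse:
  assumes "a \<in> Sq"
  shows "quad_char (1 - inverse a) = - quad_char (1 - a)"
proof -
  have "1 - inverse a = inverse a * (a - 1)"
    using Sq_nonzero[OF assms] by (simp add: field_simps)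
  then have "quad_char (1 - inverse a) = quad_char (a - 1)"
    using quad_char_Sq_mult[OF Sq_inverse[OF assms]] by metis
  then show ?thesis by (metis quad_char_diff_commute)
qed

lemma mu_minus:
  assumes "k \<le> n"
  shows "mu (n - k) = - mu k"
proof -
  have "mu (n - k) = (\<Sum>a\<in>Sq. quad_char (1 - inverse (inverse a)) * \<chi> (inverse a) ^ k)"
    using assms chi_power_minus by (auto simp: mu_def intro!: sum.cong)
  also have "\<dots> = (\<Sum>a\<in>Sq. quad_char (1 - inverse a) * \<chi> a ^ k)"
    by (rule sum_Sq_inverse)
  also have "\<dots> = - mu k"
    by (simp add: quad_char_one_minus_inverse mu_def sum_negf)
  finally show ?thesis .
qed

text \<open>\<chi>^n is trivial on \<open>Sq\<close>, so \<open>mu n = mu 0\<close>, whereas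
  \<open>mu_minus\<close> makes them negatives of each other.\<close>

lemma mu_0: "mu 0 = 0"
proof -
  have "mu n = mu 0"
    by (simp add: mu_def chi_Sq_power_n)
  with mu_minus[of 0] show ?thesis by simp
qed

lemma sum_quad_char_diff: "b \<in> Sq \<Longrightarrow> (\<Sum>c\<in>Sq. quad_char (b - c)) = 0"
  using mu_convolution[of b 0] mu_0 by simp

lemma jacobi_sum_eq:
  "jacobi_sum quad_char (char_pow \<chi> i) = (\<Sum>x\<in>UNIV - {0}. quad_char (1 - x) * \<chi> x powi i)"
proof -
  have "jacobi_sum quad_char (char_pow \<chi> i) = (\<Sum>x\<in>UNIV. quad_char (1 - x) * char_pow \<chi> i x)"
    unfolding jacobi_sum_def by (rule sum.reindex_bij_witness[of _ "\<lambda>x. 1 - x" "\<lambda>x. 1 - x"]) auto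
  also have "\<dots> = (\<Sum>x\<in>UNIV - {0}. quad_char (1 - x) * \<chi> x powi i)"
    by (rule sum.mono_neutral_cong_right) (auto simp: char_pow_def)
  finally show ?thesis .
qed

lemma jacobi_sum_diff:
  "jacobi_sum quad_char (char_pow \<chi> (int k)) - jacobi_sum quad_char (char_pow \<chi> (- int k)) = 2 * mu k"
proof -
  have "jacobi_sum quad_char (char_pow \<chi> (- int k))
      = (\<Sum>x\<in>UNIV - {0}. quad_char (1 - inverse x) * \<chi> x ^ k)"
    unfolding jacobi_sum_eq
    by (rule sum.reindex_bij_witness[of _ inverse inverse])
       (auto simp: chi_inverse power_int_minus power_inverse)
  also have "\<dots> = (\<Sum>x\<in>UNIV - {0}. - (quad_char x * quad_char (1 - x)) * \<chi> x ^ k)"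
  proof (intro sum.cong refl)
    fix x :: 'a assume x: "x \<in> UNIV - {0}"
    then have "quad_char (x * (1 - inverse x)) = - quad_char (1 - x)"
      by (simp add: right_diff_distrib) (rule quad_char_diff_commute)
    moreover have "quad_char x * quad_char x = 1"
      using x by (auto simp: quad_char_def)
    ultimately have "quad_char (1 - inverse x) = - (quad_char x * quad_char (1 - x))"
      by (metis mult.assoc mult.left_neutral mult_minus_right quad_char_mult)
    then show "quad_char (1 - inverse x) * \<chi> x ^ k = - (quad_char x * quad_char (1 - x)) * \<chi> x ^ k"
      by simp
  qed
  \<comment> \<open>The weight 1 + \<phi>(x) is 2 on nonzero squares and 0 on nonsquares, which
    confines the sum to \<open>Sq\<close>.\<close>
  finally have "jacobi_sum quad_char (char_pow \<chi> (int k)) - jacobi_sum quad_char (char_pow \<chi> (- int k))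
      = (\<Sum>x\<in>UNIV - {0}. (1 + quad_char x) * (quad_char (1 - x) * \<chi> x ^ k))"
    by (simp add: jacobi_sum_eq algebra_simps flip: sum_subtractf)
  also have "\<dots> = (\<Sum>x\<in>Sq. 2 * (quad_char (1 - x) * \<chi> x ^ k))"
    by (rule sum.mono_neutral_cong_right) (auto simp: Sq_def quad_char_def split: if_splits)
  also have "\<dots> = 2 * mu k"
    by (simp add: mu_def sum_distrib_left)
  finally show ?thesis .
qed

text \<open>Since n = 2m + 1, the range 0 < k < n/2 is 1, ..., m; it is shifted to start at
  0.\<close>

lemma jacobi_diff_prod_eq: "jacobi_diff_prod n \<chi> = 2 ^ m * (\<Prod>k<m. mu (Suc k))"
proof -
  have "jacobi_diff_prod n \<chi> = (\<Prod>k<m. 2 * mu (Suc k))"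
    unfolding jacobi_diff_prod_def
  proof (rule prod.reindex_bij_witness[of _ "\<lambda>k. int (Suc k)" "\<lambda>i. nat i - 1"])
    fix i assume "i \<in> {k. 0 < k \<and> real_of_int k < real n / 2}"
    then have "0 < i" and "real_of_int (2 * i) < real_of_int (int n)" by auto
    then have i: "0 < i" "2 * i < int n" by linarith+
    then show "int (Suc (nat i - 1)) = i" "nat i - 1 \<in> {..<m}" by (auto simp: n)
    show "2 * mu (Suc (nat i - 1)) =
        jacobi_sum quad_char (char_pow \<chi> i) - jacobi_sum quad_char (char_pow \<chi> (- i))"
      using i jacobi_sum_diff[of "nat i"] by simp
  qed (auto simp: n)
  then show ?thesis by (simp add: prod.distrib)
qed

text \<open>The indices m + 1, ..., 2m are folded back by k -> n - k, each contributing a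
  sign.\<close>

lemma prod_mu: "(\<Prod>k<2 * m. mu (Suc k)) = (- 1) ^ m * (\<Prod>k<m. mu (Suc k))\<^sup>2"
proof -
  have "(\<Prod>k<m + m. mu (Suc k)) = (\<Prod>k<m. mu (Suc k)) * (\<Prod>k=m..<m + m. mu (Suc k))"
    by (metis prod.atLeastLessThan_concat atLeast0LessThan le0 le_add1)
  also have "(\<Prod>k=m..<m + m. mu (Suc k)) = (\<Prod>j<m. mu (n - Suc j))"
    by (rule prod.reindex_bij_witness[of _ "\<lambda>j. 2 * m - Suc j" "\<lambda>i. 2 * m - Suc i"])
       (auto simp: n)
  also have "\<dots> = (\<Prod>j<m. - mu (Suc j))"
    using mu_minus Suc_le_n by simp
  also have "\<dots> = (- 1) ^ m * (\<Prod>k<m. mu (Suc k))"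
    by (simp add: prod_uminus)
  finally show ?thesis by (simp add: power2_eq_square mult.left_commute flip: mult_2)
qed

section \<open>Determinant identities\<close>

lemma sum_chi_powers_Suc:
  assumes "a \<in> Sq"
  shows "(\<Sum>k<2 * m. \<chi> a ^ Suc k) = (if a = 1 then of_nat n else 0) - 1"
proof -
  have "(\<Sum>k<n. \<chi> a ^ k) = 1 + (\<Sum>k<2 * m. \<chi> a ^ Suc k)"
    by (simp add: n sum.lessThan_Suc_shift del: sum.lessThan_Suc power_Suc)
  then show ?thesis using sum_chi_powers[OF assms] by (simp add: algebra_simps)
qed

text \<open>The matrix on the right is the group matrix without the row and column of 1. The
  nontrivial characters restricted to \<open>Sq - {1}\<close> diagonalize it up to a correction
  matrix of determinant n.\<close>

lemma prod_mu_eq_det: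
  assumes e: "bij_betw e {..<2 * m} (Sq - {1})"
  shows "(\<Prod>k<2 * m. mu (Suc k))
    = of_nat n * det (mat (2 * m) (2 * m) (\<lambda>(i, j). quad_char (e i - e j)))"
proof -
  define N where "N = 2 * m"
  have nN: "n = Suc N" by (simp add: n N_def)
  have e_Sq: "e i \<in> Sq" "e i \<noteq> 1" if "i < N" for i
    using e that by (auto simp: bij_betw_def N_def)
  have e_inj: "e i = e j \<longleftrightarrow> i = j" if "i < N" "j < N" for i j
    using inj_onD[OF bij_betw_imp_inj_on[OF e]] that by (auto simp: N_def)
  have sum_e: "(\<Sum>k<N. F (e k)) = (\<Sum>c\<in>Sq. F c) - F 1" for F :: "'a \<Rightarrow> complex"
    using sum.reindex_bij_betw[OF e, of F] sum.remove[OF finite_Sq one_in_Sq, of F]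
    by (simp add: N_def)
  define W where "W = mat N N (\<lambda>(i, k). \<chi> (e i) ^ Suc k)"
  define W' where "W' = mat N N (\<lambda>(i, k). \<chi> (e i) ^ Suc k - 1)"
  define V where "V = mat N N (\<lambda>(k, j). \<chi> (inverse (e j)) ^ Suc k - 1)"
  define D where "D = mat N N (\<lambda>(i, j). if i = j then mu (Suc i) else 0)"
  define Q :: "complex mat" where "Q = mat N N (\<lambda>(i, j). quad_char (e i - e j))"
  define K :: "complex mat" where "K = mat N N (\<lambda>(i, j). if i = j then 1 + 1 else 1)"
  have carrier: "W \<in> carrier_mat N N" "W' \<in> carrier_mat N N" "V \<in> carrier_mat N N"
    "D \<in> carrier_mat N N" "Q \<in> carrier_mat N N" "K \<in> carrier_mat N N"
    by (simp_all add: W_def W'_def V_def D_def Q_def K_def)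
  \<comment> \<open>Subtracting 1 from a character kills its value at the missing point 1, so the
    sum over \<open>e\<close> is a sum over all of \<open>Sq\<close>. The subtracted constant
    contributes nothing because the kernel has zero row sums.\<close>
  have "W * D = Q * W'"
    unfolding W_def W'_def D_def Q_def mat_mult_mat
  proof (rule cong_mat[OF refl refl], simp only: prod.case)
    fix i j assume ij: "i < N" "j < N"
    have "(\<Sum>k<N. quad_char (e i - e k) * (\<chi> (e k) ^ Suc j - 1))
        = (\<Sum>c\<in>Sq. quad_char (e i - c) * (\<chi> c ^ Suc j - 1))"
      by (subst sum_e) (simp add: chi_1)
    also have "\<dots> = mu (Suc j) * \<chi> (e i) ^ Suc j"
      using e_Sq[OF ij(1)] mu_convolution[of "e i" "Suc j"] sum_quad_char_diff[of "e i"]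
      by (simp add: right_diff_distrib sum_subtractf del: power_Suc)
    finally show "(\<Sum>k<N. \<chi> (e i) ^ Suc k * (if k = j then mu (Suc k) else 0))
        = (\<Sum>k<N. quad_char (e i - e k) * (\<chi> (e k) ^ Suc j - 1))"
      using ij by (simp add: if_distrib[of "\<lambda>x. _ * x"] mult.commute del: power_Suc cong: if_cong)
  qed
  then have 1: "det W * det D = det Q * det W'"
    using carrier by (metis det_mult)
  \<comment> \<open>\<open>K\<close> is I + J. A nontrivial character sums to 0 over
    \<open>Sq\<close>, hence to -1 over \<open>Sq - {1}\<close>, and J supplies exactly the -1 of
    \<open>W'\<close>.\<close>
  have "W' = K * W"
    unfolding W_def W'_def K_def mat_mult_mat
  proof (rule cong_mat[OF refl refl], simp only: prod.case)
    fix i j assume ij: "i < N" "j < N"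
    have "(\<Sum>k<N. (if i = k then 1 + 1 else 1) * \<chi> (e k) ^ Suc j)
        = (\<Sum>k<N. (if k = i then \<chi> (e i) ^ Suc j else 0) + \<chi> (e k) ^ Suc j)"
      by (rule sum.cong) auto
    also have "\<dots> = \<chi> (e i) ^ Suc j + ((\<Sum>c\<in>Sq. \<chi> c ^ Suc j) - \<chi> 1 ^ Suc j)"
      using ij sum_e[of "\<lambda>c. \<chi> c ^ Suc j"] by (simp add: sum.distrib del: power_Suc)
    also have "\<dots> = \<chi> (e i) ^ Suc j - 1"
      using ij sum_Sq_chi_power[of "Suc j"] by (simp add: chi_1 nN del: power_Suc)
    finally show "\<chi> (e i) ^ Suc j - 1 = (\<Sum>k<N. (if i = k then 1 + 1 else 1) * \<chi> (e k) ^ Suc j)" ..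
  qed
  then have "det W' = det K * det W"
    using carrier by (simp add: det_mult)
  moreover have "det K = of_nat n"
    using det_scalar_plus_const[of "1 :: complex" N 1] by (simp add: K_def nN)
  ultimately have 2: "det W' = of_nat n * det W" by simp
  \<comment> \<open>This is needed only for the invertibility of \<open>W\<close>. The -1 in
    \<open>V\<close> compensates for the trivial character absent from the orthogonality
    sum.\<close>
  have WV: "W * V = mat N N (\<lambda>(i, j). if i = j then of_nat n else 0)"
    unfolding W_def V_def mat_mult_mat
  proof (rule cong_mat[OF refl refl], simp only: prod.case)
    fix i j assume ij: "i < N" "j < N"
    have "(\<Sum>k<N. \<chi> (e i) ^ Suc k * (\<chi> (inverse (e j)) ^ Suc k - 1))
        = (\<Sum>k<N. \<chi> (e i / e j) ^ Suc k) - (\<Sum>k<N. \<chi> (e i) ^ Suc k)"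
      by (simp add: right_diff_distrib sum_subtractf divide_inverse chi_mult power_mult_distrib
          del: power_Suc)
    also have "\<dots> = (if e i / e j = 1 then of_nat n else 0)"
      using e_Sq ij by (simp add: N_def sum_chi_powers_Suc Sq_divide del: power_Suc)
    also have "e i / e j = 1 \<longleftrightarrow> i = j"
      using ij e_inj e_Sq Sq_nonzero by (simp add: divide_eq_1_iff)
    finally show "(\<Sum>k<N. \<chi> (e i) ^ Suc k * (\<chi> (inverse (e j)) ^ Suc k - 1))
        = (if i = j then of_nat n else 0)" .
  qed
  have "det W * det V = of_nat n ^ N"
    using det_mult[OF carrier(1,3)] by (simp add: WV det_diagonal_mat)
  then have "det W \<noteq> 0" using n_nonzero by auto
  with 1 2 have "det D = of_nat n * det Q" by simp
  then show ?thesis by (simp add: D_def Q_def N_def det_diagonal_mat)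
qed

section \<open>Integrality through odd and even functions on the squares\<close>

lemma quad_char_diff_inverse:
  assumes "x \<in> Sq" "y \<in> Sq"
  shows "quad_char (x - inverse y) = - quad_char (inverse x - y)"
proof -
  \<comment> \<open>The factor x/y is a square, so \<phi> ignores it.\<close>
  have "x - inverse y = (x / y) * (y - inverse x)"
    using assms Sq_nonzero by (simp add: field_simps)
  then have "quad_char (x - inverse y) = quad_char (y - inverse x)"
    using quad_char_Sq_mult[OF Sq_divide[OF assms]] by metis
  then show ?thesis by (metis quad_char_diff_commute)
qed

text \<open>
  This avoids Pfaffians: \<open>A\<close> is the matrix of convolution with \<open>\<lambda>a. quad_char (a - 1)\<close> from the odd
  functions on \<open>Sq\<close> to the even ones; \<open>E\<close> and \<open>F\<close> collect the
  even and odd parts of the characters.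
\<close>

lemma prod_mu_half_square:
  obtains r where "r \<in> \<int>" and "(\<Prod>k<m. mu (Suc k))\<^sup>2 = (- 1) ^ m * of_nat n * r\<^sup>2"
proof -
  define t where "t i = h ^ Suc i" for i
  have t_Sq: "t i \<in> Sq" for i
    unfolding t_def by (rule h_power_in_Sq)
  have t_nonzero: "t i \<noteq> 0" for i
    using t_Sq Sq_nonzero by blast
  have t_inj: "t i = t j \<longleftrightarrow> i = j" if "i < m" "j < m" for i j
    using that h_power_eq_iff[of "Suc i" "Suc j"] by (simp add: t_def n del: power_Suc)
  \<comment> \<open>The exponent i + j + 2 lies strictly between 0 and n. So the \<open>t i\<close>
    contain at most one element of each pair {a, 1/a}, and no 1.\<close>
  have t_mult: "t i * t j \<noteq> 1" if "i < m" "j < m" for i j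
    using that h_power_eq_iff[of "Suc i + Suc j" 0]
    by (simp add: t_def n flip: power_add del: power_Suc)
  define E where "E = mat m m (\<lambda>(i, k). \<chi> (t i) ^ Suc k + \<chi> (inverse (t i)) ^ Suc k)"
  define F where "F = mat m m (\<lambda>(i, k). \<chi> (t i) ^ Suc k - \<chi> (inverse (t i)) ^ Suc k)"
  define D where "D = mat m m (\<lambda>(i, j). if i = j then mu (Suc i) else 0)"
  define A :: "complex mat" where
    "A = mat m m (\<lambda>(i, j). quad_char (t i - t j) + quad_char (inverse (t i) - t j))"
  have carrier: "E \<in> carrier_mat m m" "F \<in> carrier_mat m m"
    "D \<in> carrier_mat m m" "A \<in> carrier_mat m m"
    by (simp_all add: E_def F_def D_def A_def)

  have "E * D = A * F"
    unfolding E_def F_def D_def A_def mat_mult_mat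
  proof (rule cong_mat[OF refl refl], simp only: prod.case)
    fix i j assume ij: "i < m" "j < m"
    define H where "H c = quad_char (t i - c) + quad_char (inverse (t i) - c)" for c
    \<comment> \<open>Symmetrizing the kernel in its first argument makes it odd under inversion of
      the second. The sum over \<open>Sq\<close> therefore folds onto the \<open>t k\<close> and
      sees only the odd part of the character.\<close>
    have H_inverse: "H (inverse c) = - H c" if "c \<in> Sq" for c
      using quad_char_diff_inverse[OF t_Sq that] quad_char_diff_inverse[OF Sq_inverse[OF t_Sq] that]
      by (simp add: H_def)
    from H_inverse[OF one_in_Sq] have H_1: "H 1 = 0" by simp
    have "(\<chi> (t i) ^ Suc j + \<chi> (inverse (t i)) ^ Suc j) * mu (Suc j)
        = (\<Sum>c\<in>Sq. H c * \<chi> c ^ Suc j)"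
      using mu_convolution[OF t_Sq, of i "Suc j"]
        mu_convolution[OF Sq_inverse[OF t_Sq], of i "Suc j"]
      by (simp add: H_def distrib_right distrib_left sum.distrib mult.commute del: power_Suc)
    also have "\<dots> = (\<Sum>k<m. H (t k) * (\<chi> (t k) ^ Suc j - \<chi> (inverse (t k)) ^ Suc j))"
      by (subst sum_Sq_split)
         (simp add: H_1 H_inverse t_Sq right_diff_distrib del: power_Suc flip: t_def)
    finally show "(\<Sum>k<m. (\<chi> (t i) ^ Suc k + \<chi> (inverse (t i)) ^ Suc k)
          * (if k = j then mu (Suc k) else 0))
        = (\<Sum>k<m. (quad_char (t i - t k) + quad_char (inverse (t i) - t k))
          * (\<chi> (t k) ^ Suc j - \<chi> (inverse (t k)) ^ Suc j))"
      using ij by (simp add: H_def if_distrib[of "\<lambda>x. _ * x"] del: power_Suc cong: if_cong)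
  qed
  then have ED: "det E * det D = det A * det F"
    using carrier by (metis det_mult)

  \<comment> \<open>Multiplying out gives a half sum at \<open>t i * t j\<close>, always -1, minus
    one at \<open>t i / t j\<close>, which is n - 1 on the diagonal and -1 elsewhere.\<close>
  have FF: "F * transpose_mat F = mat m m (\<lambda>(i, j). if i = j then - of_nat n else 0)"
    unfolding F_def mat_mult_transpose_mat
  proof (rule cong_mat[OF refl refl], simp only: prod.case)
    fix i j assume ij: "i < m" "j < m"
    have "(\<Sum>k<m. (\<chi> (t i) ^ Suc k - \<chi> (inverse (t i)) ^ Suc k)
          * (\<chi> (t j) ^ Suc k - \<chi> (inverse (t j)) ^ Suc k))
        = (\<Sum>k<m. \<chi> (t i * t j) ^ Suc k + \<chi> (inverse (t i * t j)) ^ Suc k)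
          - (\<Sum>k<m. \<chi> (t i / t j) ^ Suc k + \<chi> (inverse (t i / t j)) ^ Suc k)"
      by (simp add: sum_subtractf sum.distrib divide_inverse chi_mult power_mult_distrib
          algebra_simps del: power_Suc)
    also have "\<dots> = (if i = j then - of_nat n else 0)"
      using ij by (subst (1 2) sum_chi_powers_half) (auto simp: t_Sq Sq_mult Sq_divide t_mult t_inj t_nonzero)
    finally show "(\<Sum>k<m. (\<chi> (t i) ^ Suc k - \<chi> (inverse (t i)) ^ Suc k)
          * (\<chi> (t j) ^ Suc k - \<chi> (inverse (t j)) ^ Suc k)) = (if i = j then - of_nat n else 0)" .
  qed
  have "det F * det F = (- of_nat n) ^ m"
    using det_mult[OF carrier(2), of "transpose_mat F"] carrier(2)
    by (simp add: FF det_transpose det_diagonal_mat)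
  then have F: "(det F)\<^sup>2 = (- 1) ^ m * of_nat n ^ m"
    by (simp add: power2_eq_square flip: power_mult_distrib)

  \<comment> \<open>The same two half sums are now added, giving nI - 2J, in the shape a + b for
    \<open>det_scalar_plus_const\<close>.\<close>
  have EE: "E * transpose_mat E = mat m m (\<lambda>(i, j). if i = j then of_nat n + - 2 else - 2)"
    unfolding E_def mat_mult_transpose_mat
  proof (rule cong_mat[OF refl refl], simp only: prod.case)
    fix i j assume ij: "i < m" "j < m"
    have "(\<Sum>k<m. (\<chi> (t i) ^ Suc k + \<chi> (inverse (t i)) ^ Suc k)
          * (\<chi> (t j) ^ Suc k + \<chi> (inverse (t j)) ^ Suc k))
        = (\<Sum>k<m. \<chi> (t i * t j) ^ Suc k + \<chi> (inverse (t i * t j)) ^ Suc k)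
          + (\<Sum>k<m. \<chi> (t i / t j) ^ Suc k + \<chi> (inverse (t i / t j)) ^ Suc k)"
      by (simp add: sum.distrib divide_inverse chi_mult power_mult_distrib
          algebra_simps del: power_Suc)
    also have "\<dots> = (if i = j then of_nat n + - 2 else - 2)"
      using ij by (subst (1 2) sum_chi_powers_half) (auto simp: t_Sq Sq_mult Sq_divide t_mult t_inj t_nonzero)
    finally show "(\<Sum>k<m. (\<chi> (t i) ^ Suc k + \<chi> (inverse (t i)) ^ Suc k)
          * (\<chi> (t j) ^ Suc k + \<chi> (inverse (t j)) ^ Suc k)) = (if i = j then of_nat n + - 2 else - 2)" .
  qed
  have "det E * det E
      = det (mat m m (\<lambda>(i, j). if i = j then of_nat n + - 2 else - 2 :: complex))"
    using det_mult[OF carrier(1), of "transpose_mat E"] carrier(1)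
    by (simp add: EE det_transpose)
  then have "of_nat n * (det E)\<^sup>2 = of_nat n ^ m * (of_nat n + of_nat m * - 2 :: complex)"
    unfolding power2_eq_square by (simp only: det_scalar_plus_const)
  \<comment> \<open>The remaining factor n - 2m equals 1.\<close>
  then have E: "of_nat n * (det E)\<^sup>2 = (of_nat n ^ m :: complex)"
    by (simp add: n)

  have "of_nat n ^ m * (det D)\<^sup>2 = of_nat n * (det E * det D)\<^sup>2"
    unfolding E[symmetric] power_mult_distrib by (simp add: mult_ac)
  also have "\<dots> = of_nat n ^ m * ((- 1) ^ m * of_nat n * (det A)\<^sup>2)"
    unfolding ED power_mult_distrib F by (simp add: mult_ac)
  finally have "(det D)\<^sup>2 = (- 1) ^ m * of_nat n * (det A)\<^sup>2"
    using n_nonzero by simp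
  moreover have "det D = (\<Prod>k<m. mu (Suc k))"
    by (simp add: D_def det_diagonal_mat)
  moreover have "det A \<in> \<int>"
    using carrier(4) by (rule det_in_Ints) (simp add: A_def quad_char_in_Ints)
  ultimately show ?thesis using that by simp
qed

end

section \<open>Passage from the eigenvalues to x_q\<close>

theorem theorem1p1:
  fixes \<chi> :: "'a::finite_field \<Rightarrow> complex"
    and s :: "nat \<Rightarrow> 'a"
    and n :: nat
  assumes "card (UNIV :: 'a set) = 2 * n + 1"
    and "card (UNIV :: 'a set) mod 4 = 3"
    and "char_generator \<chi>"
    and "bij_betw s {0..n} {x\<^sup>2 | x. True}"
    and "s 0 = 0"
    and "s 1 = 1"
  shows "let x = jacobi_diff_prod n \<chi> / csqrt ((-1) ^ ((n - 1) div 2) * of_nat n)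
         in x \<in> \<int> \<and>
            x\<^sup>2 = 2 ^ (n - 1) *
              det (mat (n - 1) (n - 1) (\<lambda>(i, j). quad_char (s (i + 2) - s (j + 2))))"
proof -
  define m where "m = n div 2"
  have n: "n = 2 * m + 1" using assms(1,2) unfolding m_def by presburger
  interpret quadratic_residues \<chi> m n
    by unfold_locales (fact assms(1) n assms(3))+
  define L where "L = (\<Prod>k<m. mu (Suc k))"
  define c where "c = csqrt ((-1) ^ m * of_nat n)"
  define M where "M = mat (2 * m) (2 * m) (\<lambda>(i, j). quad_char (s (i + 2) - s (j + 2)))"
  \<comment> \<open>Only the square of the root is used below, so the choice of branch does not
    affect the argument.\<close>
  have c: "c\<^sup>2 = (-1) ^ m * of_nat n" by (simp add: c_def)
  with n_nonzero have c0: "c \<noteq> 0" by auto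
  \<comment> \<open>The shift by 2 drops s_0 = 0 and s_1 = 1, leaving the n - 1 = 2m squares other
    than 0 and 1.\<close>
  have "bij_betw (\<lambda>i. s (i + 2)) {..<2 * m} (Sq - {1})"
    unfolding bij_betw_def
  proof
    have inj: "inj_on s {0..n}" and img: "s ` {0..n} = {x\<^sup>2 | x. True}"
      using assms(4) by (auto simp: bij_betw_def)
    show "inj_on (\<lambda>i. s (i + 2)) {..<2 * m}"
    proof (rule inj_onI)
      fix i j assume "i \<in> {..<2 * m}" "j \<in> {..<2 * m}" "s (i + 2) = s (j + 2)"
      then show "i = j" using inj_onD[OF inj, of "i + 2" "j + 2"] by (simp add: n)
    qed
    have "(\<lambda>i. i + 2) ` {..<2 * m} = {0..n} - {0, 1}"
      unfolding lessThan_atLeast0 image_add_atLeastLessThan' by (auto simp: n)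
    then have "(\<lambda>i. s (i + 2)) ` {..<2 * m} = s ` ({0..n} - {0, 1})"
      by (metis image_image)
    also have "\<dots> = s ` {0..n} - s ` {0, 1}"
      by (rule inj_on_image_set_diff[OF inj]) (auto simp: n)
    also have "\<dots> = Sq - {1}"
      using assms(5,6) by (auto simp: img Sq_iff)
    finally show "(\<lambda>i. s (i + 2)) ` {..<2 * m} = Sq - {1}" .
  qed
  from prod_mu_eq_det[OF this] have "(- 1) ^ m * L\<^sup>2 = of_nat n * det M"
    by (simp add: prod_mu L_def M_def)
  then have "L\<^sup>2 = (- 1) ^ m * (of_nat n * det M)"
    by (metis left_minus_one_mult_self)
  then have L: "L\<^sup>2 = c\<^sup>2 * det M" by (simp add: c)
  obtain r where r: "r \<in> \<int>" "L\<^sup>2 = c\<^sup>2 * r\<^sup>2"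
    using prod_mu_half_square unfolding L_def c by metis
  define x where "x = jacobi_diff_prod n \<chi> / c"
  have x: "x = 2 ^ m * L / c"
    by (simp add: x_def jacobi_diff_prod_eq L_def)
  then have "x\<^sup>2 = (2 ^ m)\<^sup>2 * det M"
    using c0 by (simp add: power_mult_distrib power_divide L)
  then have "x\<^sup>2 = 2 ^ (2 * m) * det M"
    by (simp add: power_mult mult.commute flip: power_mult)
  moreover have "x \<in> \<int>"
  proof -
    \<comment> \<open>Equal squares in a field give x up to sign, which is enough for
      integrality.\<close>
    have "x\<^sup>2 = (2 ^ m * r)\<^sup>2"
      using c0 by (simp add: x power_mult_distrib power_divide r(2))
    then have "x = 2 ^ m * r \<or> x = - (2 ^ m * r)"
      by (simp add: power2_eq_iff)
    moreover have "2 ^ m * r \<in> \<int>" using r(1) by (intro Ints_mult Ints_power) simp_all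
    ultimately show ?thesis by auto
  qed
  moreover have "n - 1 = 2 * m" "(n - 1) div 2 = m" by (simp_all add: n)
  ultimately show ?thesis
    unfolding Let_def x_def c_def M_def by simp
qed

end
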